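(* For all positive integers $n,m$, $\mathcal{D}_n^m=d_n^m$.
   Context: Let $\mathcal{E}=\{e_1,\dots,e_n\}$ be the standard basis of $\mathbb{Z}^n$. For a lattice $\Lambda$ with $\mathbb{Z}^n\subseteq\Lambda\subset\mathbb{Q}^n$, the defect $d(\mathcal{E},\Lambda)$ is the smallest integer $d$ such that some $n-d$ vectors of $\mathcal{E}$ together with some $d$ vectors of $\Lambda$ form a basis of $\Lambda$. The unit octahedron $O^n=\{x\in\mathbb{R}^n: |x_1|+\dots+|x_n|\le 1\}$ is admissible with respect to $\Lambda$ if $O^n\cap\Lambda=\{0,\pm e_1,\dots,\pm e_n\}$. $\mathcal{A}_m$ is the set of lattices $\langle \mathbb{Z}^n,a_1,\dots,a_m\rangle_{\mathbb{Z}}$ with $a_i\in\mathbb{Q}^n$, and $\mathcal{A}^*_m\subseteq\mathcal{A}_m$ the subset of those for which some square-free positive integer $q$ satisfies $qa_1,\dots,qa_m\in\mathbb{Z}^n$. $d_n^m$ (resp. $\mathcal{D}_n^m$) is the maximum of $d(\mathcal{E},\Lambda)$ over all $\Lambda\in\mathcal{A}_m$ (resp. $\Lambda\in\mathcal{A}^*_m$) with respect to which $O^n$ is admissible. *)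

theory Defs
  imports "HOL-Analysis.Analysis" "HOL-Computational_Algebra.Squarefree"
begin

global_interpretation int_module: module "\<lambda>(k::int) (x::'a::real_vector). of_int k *\<^sub>R x"
  defines int_dependent = int_module.dependent
    and int_span = int_module.span
  by unfold_locales (simp_all add: scaleR_add_right scaleR_add_left)

definition is_lattice_basis :: "'a::real_vector set \<Rightarrow> 'a set \<Rightarrow> bool" where
  "is_lattice_basis B L \<longleftrightarrow> \<not> int_dependent B \<and> int_span B = L"

definition int_vectors :: "(real ^ 'n) set" where
  "int_vectors = {x. \<forall>i. x $ i \<in> \<int>}"

definition rat_vectors :: "(real ^ 'n) set" where
  "rat_vectors = {x. \<forall>i. x $ i \<in> \<rat>}"

definition std_basis :: "(real ^ 'n) set" where
  "std_basis = range (\<lambda>i. axis i 1)"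

text \<open>The vectors chosen from the standard basis and from the lattice are together counted
  as a family of \<open>n\<close> vectors, so the two sets are disjoint.  The condition on the
  cardinalities encodes \<open>card S = n - d\<close> with \<open>d \<le> n\<close>.\<close>

definition defect :: "(real ^ 'n) set \<Rightarrow> nat" where
  "defect L = (LEAST d. \<exists>S T. S \<subseteq> std_basis \<and> card S + d = CARD('n) \<and>
     T \<subseteq> L \<and> finite T \<and> card T = d \<and> S \<inter> T = {} \<and> is_lattice_basis (S \<union> T) L)"

definition unit_octahedron :: "(real ^ 'n) set" where
  "unit_octahedron = {x. (\<Sum>i\<in>UNIV. \<bar>x $ i\<bar>) \<le> 1}"

definition octahedron_admissible :: "(real ^ 'n) set \<Rightarrow> bool" where
  "octahedron_admissible L \<longleftrightarrow> unit_octahedron \<inter> L = {0} \<union> std_basis \<union> uminus ` std_basis"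

definition lattices_gen :: "nat \<Rightarrow> (real ^ 'n) set set" where
  "lattices_gen m = {int_span (int_vectors \<union> a ` {1..m}) | a. \<forall>i\<in>{1..m}. a i \<in> rat_vectors}"

definition lattices_gen_squarefree :: "nat \<Rightarrow> (real ^ 'n) set set" where
  "lattices_gen_squarefree m =
     {int_span (int_vectors \<union> a ` {1..m}) | a. (\<forall>i\<in>{1..m}. a i \<in> rat_vectors) \<and>
        (\<exists>q::nat. q > 0 \<and> squarefree q \<and> (\<forall>i\<in>{1..m}. of_nat q *\<^sub>R a i \<in> int_vectors))}"

text \<open>The dimension is the cardinality of the index type, passed as a type argument.
  The sets below are nonempty (take all generators zero) and bounded by the dimension,
  so \<open>Max\<close> is a genuine maximum.\<close>

definition max_defect :: "'n::finite itself \<Rightarrow> nat \<Rightarrow> nat" where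
  "max_defect _ m =
     Max {defect L | L :: (real ^ 'n) set. L \<in> lattices_gen m \<and> octahedron_admissible L}"

definition max_defect_squarefree :: "'n::finite itself \<Rightarrow> nat \<Rightarrow> nat" where
  "max_defect_squarefree _ m =
     Max {defect L | L :: (real ^ 'n) set. L \<in> lattices_gen_squarefree m \<and> octahedron_admissible L}"

end

theory Submission
  imports Defs
begin

text \<open>Only the socle of \<open>\<Lambda>/\<int>\<^sup>n\<close> matters for the defect.  A subset of the standard basis extends to
  a basis of \<open>\<Lambda>\<close> iff it is primitive, that is, iff no nonzero class of the finite group
  \<open>\<Lambda>/\<int>\<^sup>n\<close> has a representative supported on it; if there is such a class, a multiple of it has
  prime order.  Hence, for \<open>q\<close> the product of the primes dividing the exponent of
  \<open>\<Lambda>/\<int>\<^sup>n\<close>, the sublattice \<open>\<Lambda>' = {x \<in> \<Lambda>. q x \<in> \<int>\<^sup>n}\<close> has the same defect as \<open>\<Lambda>\<close>.  It inherits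
  admissibility because it is contained in \<open>\<Lambda>\<close>, and it needs at most \<open>m\<close> generators over
  \<open>\<int>\<^sup>n\<close> because subgroups of \<open>m\<close>-generated abelian groups are \<open>m\<close>-generated.\<close>

section \<open>Subgroups of finitely generated abelian groups\<close>

text \<open>Division with remainder: remainders modulo the least positive element of
  \<open>K\<close> lie in \<open>K\<close> again, so by minimality they vanish. The zero ideal is
  the separate case \<open>d = 0\<close>.\<close>

lemma int_ideal_principal:
  fixes K :: "int set"
  assumes "0 \<in> K" and diff: "\<And>k l c. k \<in> K \<Longrightarrow> l \<in> K \<Longrightarrow> k - c * l \<in> K"
  obtains d where "d \<in> K" "\<And>k. k \<in> K \<Longrightarrow> d dvd k"
proof (cases "K \<subseteq> {0}")
  case True
  with \<open>0 \<in> K\<close> show ?thesis using that[of 0] by auto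
next
  case False
  then obtain k where k: "k \<in> K" "k \<noteq> 0" by auto
  have "\<bar>k\<bar> \<in> K"
    using k diff[OF \<open>0 \<in> K\<close> k(1), of 1] by (auto simp: abs_if)
  then have ex: "\<exists>n::nat. n > 0 \<and> int n \<in> K"
    using k by (intro exI[of _ "nat \<bar>k\<bar>"]) auto
  define d where "d = (LEAST n::nat. n > 0 \<and> int n \<in> K)"
  have d: "d > 0" "int d \<in> K" using LeastI_ex[OF ex] by (auto simp: d_def)
  have "int d dvd k" if "k \<in> K" for k
  proof (rule ccontr)
    assume "\<not> int d dvd k"
    then have pos: "k mod int d > 0"
      using d(1) by (metis mod_0_imp_dvd of_nat_0_less_iff order_le_less pos_mod_sign)
    have "k mod int d \<in> K"
      using diff[OF that d(2), of "k div int d"] by (simp add: minus_div_mult_eq_mod)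
    with pos have "nat (k mod int d) > 0 \<and> int (nat (k mod int d)) \<in> K" by simp
    then have "d \<le> nat (k mod int d)"
      unfolding d_def[symmetric] by (subst d_def) (rule Least_le)
    moreover have "k mod int d < int d" using d(1) by simp
    ultimately show False using pos by (simp add: le_nat_iff)
  qed
  with d(2) show ?thesis using that by blast
qed

text \<open>Induction on \<open>m\<close>, relative to the fixed subgroup \<open>N\<close>. The
  coefficients of the last generator that occur in \<open>M\<close> form an ideal of the integers.
  An element of \<open>M\<close> whose coefficient generates this ideal, together with generators of
  the part of \<open>M\<close> spanned by \<open>N\<close> and the earlier \<open>a i\<close>,
  generates \<open>M\<close>.\<close>

lemma subgroup_generated_by_same_number:
  fixes N M :: "'a::real_vector set" and a :: "nat \<Rightarrow> 'a"
  assumes "int_module.subspace N" "int_module.subspace M" "N \<subseteq> M"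
    and "M \<subseteq> int_span (N \<union> a ` {1..m})"
  obtains b where "\<forall>i\<in>{1..m}. b i \<in> M" "M = int_span (N \<union> b ` {1..m})"
proof -
  have "\<exists>b. (\<forall>i\<in>{1..m}. b i \<in> M) \<and> M = int_span (N \<union> b ` {1..m})"
    using assms(2-4)
  proof (induction m arbitrary: M)
    case 0
    then have "M = int_span N"
      using assms(1) by (simp add: int_module.span_eq_iff[THEN iffD2])
    then show ?case by simp
  next
    case (Suc m)
    define P where "P = int_span (N \<union> a ` {1..m})"
    have P: "int_module.subspace P" unfolding P_def by (rule int_module.subspace_span)
    have dec: "\<exists>k::int. x - of_int k *\<^sub>R a (Suc m) \<in> P" if "x \<in> M" for x
      using that Suc.prems(3)
      by (auto simp: P_def atLeastAtMostSuc_conv int_module.span_breakdown_eq dest!: subsetD)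
    \<comment> \<open>The coefficient of an element need not be unique, since
      \<open>a (Suc m)\<close> may have torsion modulo \<open>P\<close>; hence \<open>K\<close>
      collects every possible coefficient.\<close>
    define K where "K = {k::int. \<exists>x\<in>M. x - of_int k *\<^sub>R a (Suc m) \<in> P}"
    have "0 \<in> K"
      using int_module.subspace_0[OF Suc.prems(1)] int_module.subspace_0[OF P]
      by (auto simp: K_def)
    moreover have "k - c * l \<in> K" if kl: "k \<in> K" "l \<in> K" for k l c
    proof -
      from kl obtain x y where xy: "x \<in> M" "x - of_int k *\<^sub>R a (Suc m) \<in> P"
        "y \<in> M" "y - of_int l *\<^sub>R a (Suc m) \<in> P" by (auto simp: K_def)
      have "x - of_int c *\<^sub>R y \<in> M"
        using xy Suc.prems(1) int_module.subspace_diff int_module.subspace_scale by blast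
      moreover have "(x - of_int k *\<^sub>R a (Suc m)) - of_int c *\<^sub>R (y - of_int l *\<^sub>R a (Suc m)) \<in> P"
        using xy P int_module.subspace_diff int_module.subspace_scale by blast
      then have "(x - of_int c *\<^sub>R y) - of_int (k - c * l) *\<^sub>R a (Suc m) \<in> P"
        by (simp add: algebra_simps)
      ultimately show ?thesis by (auto simp: K_def)
    qed
    ultimately obtain d where d: "d \<in> K" "\<And>k. k \<in> K \<Longrightarrow> d dvd k"
      by (rule int_ideal_principal) blast+
    from d(1) obtain t where t: "t \<in> M" "t - of_int d *\<^sub>R a (Suc m) \<in> P" by (auto simp: K_def)
    have "\<exists>b. (\<forall>i\<in>{1..m}. b i \<in> M \<inter> P) \<and> M \<inter> P = int_span (N \<union> b ` {1..m})"
    proof (rule Suc.IH)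
      show "int_module.subspace (M \<inter> P)"
        using Suc.prems(1) P by (rule int_module.subspace_inter)
      show "N \<subseteq> M \<inter> P"
        using Suc.prems(2) int_module.span_superset[of "N \<union> a ` {1..m}"] by (auto simp: P_def)
    qed (simp add: P_def)
    then obtain b where b: "\<forall>i\<in>{1..m}. b i \<in> M \<inter> P" "M \<inter> P = int_span (N \<union> b ` {1..m})"
      by blast
    define b' where "b' = b(Suc m := t)"
    have img: "N \<union> b' ` {1..Suc m} = insert t (N \<union> b ` {1..m})"
      by (auto simp: b'_def atLeastAtMostSuc_conv)
    have "M = int_span (N \<union> b' ` {1..Suc m})"
    proof
      show "M \<subseteq> int_span (N \<union> b' ` {1..Suc m})"
      proof
        fix x assume x: "x \<in> M"
        then obtain k where k: "x - of_int k *\<^sub>R a (Suc m) \<in> P" using dec by blast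
        with x have "k \<in> K" by (auto simp: K_def)
        then obtain c where c: "k = d * c" using d(2) by (auto elim: dvdE)
        \<comment> \<open>Subtracting \<open>c\<close> copies of \<open>t\<close> cancels the
          coefficient of \<open>a (Suc m)\<close>, so the remainder falls into
          \<open>M \<inter> P\<close>, which the induction hypothesis covers.\<close>
        have "x - of_int c *\<^sub>R t \<in> M"
          using x t Suc.prems(1) int_module.subspace_diff int_module.subspace_scale by blast
        moreover have "(x - of_int k *\<^sub>R a (Suc m)) - of_int c *\<^sub>R (t - of_int d *\<^sub>R a (Suc m)) \<in> P"
          using k t P int_module.subspace_diff int_module.subspace_scale by blast
        then have "x - of_int c *\<^sub>R t \<in> P" by (simp add: c algebra_simps)
        ultimately show "x \<in> int_span (N \<union> b' ` {1..Suc m})"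
          unfolding img int_module.span_breakdown_eq using b(2) by blast
      qed
      show "int_span (N \<union> b' ` {1..Suc m}) \<subseteq> M"
        unfolding img using b(1) t(1) Suc.prems(1,2) by (intro int_module.span_minimal) auto
    qed
    moreover have "\<forall>i\<in>{1..Suc m}. b' i \<in> M"
      using b(1) t(1) by (auto simp: b'_def)
    ultimately show ?case by blast
  qed
  with that show ?thesis by blast
qed

section \<open>Integral, rational and coordinate vectors\<close>

lemma subspace_int_vectors: "int_module.subspace int_vectors"
  by (auto simp: int_module.subspace_def int_vectors_def)

lemma subspace_rat_vectors: "int_module.subspace rat_vectors"
  by (auto simp: int_module.subspace_def rat_vectors_def)

lemma int_vectors_subset_rat_vectors: "int_vectors \<subseteq> rat_vectors"
  using Ints_subset_Rats by (auto simp: int_vectors_def rat_vectors_def)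

lemma independent_imp_int_independent:
  assumes "independent B"
  shows "\<not> int_dependent B"
proof
  assume "int_dependent B"
  then obtain t u where tu: "finite t" "t \<subseteq> B" "(\<Sum>v\<in>t. of_int (u v) *\<^sub>R v) = 0" "\<exists>v\<in>t. u v \<noteq> (0::int)"
    unfolding int_module.dependent_explicit by blast
  then have "dependent B"
    unfolding dependent_explicit
    by (intro exI[of _ t] exI[of _ "\<lambda>v. of_int (u v)"]) auto
  with assms show False by simp
qed

text \<open>The real coordinate subspace of \<open>I\<close>. It expresses primitivity of a set of
  basis vectors: the set indexed by \<open>I\<close> is primitive in \<open>L\<close> when
  \<open>L \<inter> coordinate_vectors I \<subseteq> int_vectors\<close>.\<close>

definition coordinate_vectors :: "'n set \<Rightarrow> (real ^ 'n) set" where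
  "coordinate_vectors I = {x. \<forall>i. i \<notin> I \<longrightarrow> x $ i = 0}"

lemma subspace_coordinate_vectors: "int_module.subspace (coordinate_vectors I)"
  by (auto simp: int_module.subspace_def coordinate_vectors_def)

lemma int_vectors_coordinate:
  "int_vectors \<inter> coordinate_vectors I = int_span ((\<lambda>i. axis i 1) ` I)"
proof
  show "int_span ((\<lambda>i. axis i 1) ` I) \<subseteq> int_vectors \<inter> coordinate_vectors I"
    by (intro int_module.span_minimal int_module.subspace_inter subspace_int_vectors
        subspace_coordinate_vectors)
      (auto simp: int_vectors_def coordinate_vectors_def axis_def)
  show "int_vectors \<inter> coordinate_vectors I \<subseteq> int_span ((\<lambda>i. axis i 1) ` I)"
  proof
    fix x :: "real ^ 'a"
    assume x: "x \<in> int_vectors \<inter> coordinate_vectors I"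
    then have "\<forall>i. \<exists>k. x $ i = of_int k" by (auto simp: int_vectors_def elim!: Ints_cases)
    then obtain k where k: "\<And>i. x $ i = of_int (k i)" by metis
    have "x = (\<Sum>i\<in>I. of_int (k i) *\<^sub>R axis i 1)"
      using x by (auto simp: vec_eq_iff axis_def k[symmetric] coordinate_vectors_def if_distrib cong: if_cong)
    also have "\<dots> \<in> int_span ((\<lambda>i. axis i 1) ` I)"
      by (intro int_module.span_sum int_module.span_scale int_module.span_base) auto
    finally show "x \<in> int_span ((\<lambda>i. axis i 1) ` I)" .
  qed
qed

section \<open>Primitive sets of basis vectors and the defect\<close>

text \<open>The coordinates in \<open>J\<close> are adjoined one at a time, as in a Hermite normal
  form. The values of the new coordinate form a cyclic group, and a lattice vector attaining its
  generator extends the basis. Real independence is carried along, since it also yields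
  finiteness.\<close>

lemma coordinate_sublattice_basis:
  fixes L :: "(real ^ 'n) set"
  assumes L: "int_module.subspace L" "int_vectors \<subseteq> L"
    and q: "q > 0" "\<And>x. x \<in> L \<Longrightarrow> of_nat q *\<^sub>R x \<in> int_vectors"
    and prim: "L \<inter> coordinate_vectors I \<subseteq> int_vectors"
    and "J \<inter> I = {}"
  shows "\<exists>T. T \<subseteq> L \<and> card T = card J \<and> (\<lambda>i. axis i 1) ` I \<inter> T = {} \<and>
     independent ((\<lambda>i. axis i 1) ` I \<union> T) \<and>
     int_span ((\<lambda>i. axis i 1) ` I \<union> T) = L \<inter> coordinate_vectors (I \<union> J)"
  using finite[of J] \<open>J \<inter> I = {}\<close>
proof (induction J)
  case empty
  have "L \<inter> coordinate_vectors I = int_span ((\<lambda>i. axis i 1) ` I)"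
    using L prim unfolding int_vectors_coordinate[symmetric] by auto
  moreover have "independent ((\<lambda>i. axis i (1::real)) ` I)"
    by (rule independent_mono[OF independent_Basis]) (auto simp: Basis_vec_def)
  ultimately show ?case by (intro exI[of _ "{}"]) auto
next
  case (insert j J)
  define E where "E = (\<lambda>i. axis i (1::real)) ` I"
  from insert obtain T where T: "T \<subseteq> L" "card T = card J" "E \<inter> T = {}" "independent (E \<union> T)"
     "int_span (E \<union> T) = L \<inter> coordinate_vectors (I \<union> J)" by (auto simp: E_def)
  have j: "j \<notin> I" "j \<notin> J" using insert by auto
  define M where "M = L \<inter> coordinate_vectors (I \<union> insert j J)"
  have M: "int_module.subspace M"
    unfolding M_def using L(1) subspace_coordinate_vectors by (rule int_module.subspace_inter)
  \<comment> \<open>Coordinates of vectors of \<open>L\<close> have denominator dividing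
    \<open>q\<close>; multiplying by \<open>q\<close> makes them integers, so that the ideal lemma
    applies.\<close>
  define K where "K = {k::int. \<exists>x\<in>M. of_nat q * x $ j = of_int k}"
  have "0 \<in> K" using int_module.subspace_0[OF M] by (auto simp: K_def intro!: bexI[of _ 0])
  moreover have "k - c * l \<in> K" if kl: "k \<in> K" "l \<in> K" for k l c
  proof -
    from kl obtain x y where xy: "x \<in> M" "of_nat q * x $ j = of_int k"
      "y \<in> M" "of_nat q * y $ j = of_int l" by (auto simp: K_def)
    have "x - of_int c *\<^sub>R y \<in> M"
      using xy M int_module.subspace_diff int_module.subspace_scale by blast
    moreover have "of_nat q * (x - of_int c *\<^sub>R y) $ j = of_int (k - c * l)"
      by (simp add: xy(2,4)[symmetric] algebra_simps)
    ultimately show ?thesis unfolding K_def by blast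
  qed
  ultimately obtain d where d: "d \<in> K" "\<And>k. k \<in> K \<Longrightarrow> d dvd k"
    by (rule int_ideal_principal) blast+
  \<comment> \<open>The vector \<open>axis j 1\<close> puts \<open>q\<close> into \<open>K\<close>,
    so the generator \<open>d\<close> is nonzero and \<open>t\<close> has a nonzero coordinate at
    \<open>j\<close>.\<close>
  have "axis j 1 \<in> M"
    using L(2) by (auto simp: M_def int_vectors_def coordinate_vectors_def axis_def)
  then have "int q \<in> K" by (auto simp: K_def intro!: bexI[of _ "axis j 1"])
  then have "d \<noteq> 0" using d(2)[of "int q"] q(1) by auto
  from d(1) obtain t where t: "t \<in> M" "of_nat q * t $ j = of_int d" by (auto simp: K_def)
  with \<open>d \<noteq> 0\<close> have tj: "t $ j \<noteq> 0" by auto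
  \<comment> \<open>The old basis spans a subspace of the hyperplane where coordinate
    \<open>j\<close> vanishes, which does not contain \<open>t\<close>.\<close>
  have sub: "E \<union> T \<subseteq> {x. x $ j = 0}"
    using T(5) int_module.span_superset[of "E \<union> T"] j by (auto simp: coordinate_vectors_def)
  have "span (E \<union> T) \<subseteq> {x. x $ j = 0}"
    using sub by (rule span_minimal) (auto simp: subspace_def)
  then have tspan: "t \<notin> span (E \<union> T)" using tj by auto
  then have tnot: "t \<notin> E \<union> T" by (auto intro: span_base)
  have "independent (insert t (E \<union> T))" using tspan T(4) by (simp add: independent_insert)
  moreover have "int_span (insert t (E \<union> T)) = M"
  proof
    have "int_span (E \<union> T) \<subseteq> M"
      unfolding T(5) by (auto simp: M_def coordinate_vectors_def)
    then have "E \<union> T \<subseteq> M" using int_module.span_superset[of "E \<union> T"] by blast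
    then show "int_span (insert t (E \<union> T)) \<subseteq> M"
      by (intro int_module.span_minimal) (use t M in auto)
    show "M \<subseteq> int_span (insert t (E \<union> T))"
    proof
      fix x assume x: "x \<in> M"
      then have "of_nat q *\<^sub>R x \<in> int_vectors" using q(2) by (auto simp: M_def)
      then obtain k where k: "of_nat q * x $ j = of_int k"
        by (auto simp: int_vectors_def elim!: Ints_cases dest!: spec[of _ j])
      with x have "k \<in> K" by (auto simp: K_def)
      then obtain c where c: "k = d * c" using d(2) by (auto elim: dvdE)
      have "real q * x $ j = real q * (of_int c * t $ j)"
        using k c t(2) by (simp add: mult.left_commute)
      then have xj: "x $ j = of_int c * t $ j" using q(1) by simp
      \<comment> \<open>Subtracting \<open>c\<close> copies of \<open>t\<close> kills coordinate
        \<open>j\<close>, so the difference lies in the sublattice already spanned by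
        \<open>E \<union> T\<close>.\<close>
      have xt: "x - of_int c *\<^sub>R t \<in> M"
        using x t M int_module.subspace_diff int_module.subspace_scale by blast
      with xj have "x - of_int c *\<^sub>R t \<in> L \<inter> coordinate_vectors (I \<union> J)"
        by (auto simp: M_def coordinate_vectors_def)
      then show "x \<in> int_span (insert t (E \<union> T))"
        unfolding int_module.span_breakdown_eq T(5) by blast
    qed
  qed
  moreover have "finite (E \<union> T)"
    using independent_imp_finite[OF T(4)] .
  then have "card (insert t T) = card (insert j J)"
    using tnot T(2) insert.hyps by simp
  ultimately show ?case
    using T(1,3) t(1) tnot unfolding E_def[symmetric]
    by (intro exI[of _ "insert t T"]) (auto simp: M_def)
qed

text \<open>Subtracting two representations of a common vector gives an integer relation on
  \<open>S \<union> T\<close>. As the supports are disjoint, no coefficients merge, so independence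
  makes all of them zero.\<close>

lemma int_independent_Un_span_Int:
  fixes S T :: "'a::real_vector set"
  assumes "\<not> int_dependent (S \<union> T)" "S \<inter> T = {}"
  shows "int_span S \<inter> int_span T = {0}"
proof -
  have "x = 0" if x: "x \<in> int_span S" "x \<in> int_span T" for x
  proof -
    from x(1) obtain A f where A: "finite A" "A \<subseteq> S" "x = (\<Sum>v\<in>A. of_int (f v) *\<^sub>R v)"
      unfolding int_module.span_explicit by blast
    from x(2) obtain B g where B: "finite B" "B \<subseteq> T" "x = (\<Sum>v\<in>B. of_int (g v) *\<^sub>R v)"
      unfolding int_module.span_explicit by blast
    define h where "h v = (if v \<in> A then f v else - g v)" for v
    have disj: "A \<inter> B = {}" using A(2) B(2) assms(2) by auto
    have "(\<Sum>v\<in>A \<union> B. of_int (h v) *\<^sub>R v) = (\<Sum>v\<in>A. of_int (h v) *\<^sub>R v) + (\<Sum>v\<in>B. of_int (h v) *\<^sub>R v)"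
      using A(1) B(1) disj by (rule sum.union_disjoint)
    also have "(\<Sum>v\<in>A. of_int (h v) *\<^sub>R v) = x"
      unfolding A(3) by (intro sum.cong) (auto simp: h_def)
    also have "(\<Sum>v\<in>B. of_int (h v) *\<^sub>R v) = (\<Sum>v\<in>B. - (of_int (g v) *\<^sub>R v))"
      using disj by (intro sum.cong) (auto simp: h_def)
    also have "\<dots> = - x" unfolding B(3) by (simp add: sum_negf)
    finally have "(\<Sum>v\<in>A \<union> B. of_int (h v) *\<^sub>R v) = 0" by simp
    moreover have "finite (A \<union> B)" "A \<union> B \<subseteq> S \<union> T" using A(1,2) B(1,2) by auto
    ultimately have "\<forall>v\<in>A \<union> B. h v = 0"
      using assms(1) unfolding int_module.dependent_explicit by blast
    then have "\<forall>v\<in>A. f v = 0" unfolding h_def by (metis UnI1)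
    then show "x = 0" unfolding A(3) by simp
  qed
  then show ?thesis using int_module.span_zero by auto
qed

text \<open>A primitive set is completed coordinate by coordinate. Conversely, in a completed basis,
  a lattice vector supported on \<open>I\<close> has an integral multiple in the span of the chosen
  basis vectors, so it has no component along \<open>T\<close>.\<close>

lemma extends_to_basis_iff_primitive:
  fixes L :: "(real ^ 'n) set"
  assumes L: "int_module.subspace L" "int_vectors \<subseteq> L"
    and q: "q > 0" "\<And>x. x \<in> L \<Longrightarrow> of_nat q *\<^sub>R x \<in> int_vectors"
  shows "(\<exists>T. card ((\<lambda>i. axis i (1::real)) ` I) + d = CARD('n) \<and> T \<subseteq> L \<and> finite T \<and> card T = d \<and>
      (\<lambda>i. axis i 1) ` I \<inter> T = {} \<and> is_lattice_basis ((\<lambda>i. axis i 1) ` I \<union> T) L) \<longleftrightarrow>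
    card I + d = CARD('n) \<and> L \<inter> coordinate_vectors I \<subseteq> int_vectors"
    (is "(\<exists>T. card ?E + d = _ \<and> ?P T) \<longleftrightarrow> _")
proof -
  have "inj_on (\<lambda>i. axis i (1::real)) I" by (auto simp: inj_on_def axis_eq_axis)
  then have card: "card ?E = card I" by (rule card_image)
  have "\<exists>T. ?P T" if "card I + d = CARD('n)" and prim: "L \<inter> coordinate_vectors I \<subseteq> int_vectors"
  proof -
    \<comment> \<open>With \<open>J = - I\<close> the coordinate subspace of
      \<open>I \<union> J\<close> is the whole space.\<close>
    from coordinate_sublattice_basis[OF L q prim, of "- I"] obtain T where T: "T \<subseteq> L"
      "card T = card (- I)" "?E \<inter> T = {}" "independent (?E \<union> T)" "int_span (?E \<union> T) = L"
      by (auto simp: coordinate_vectors_def)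
    moreover have "finite T" using independent_imp_finite[OF T(4)] by simp
    moreover have "card (- I) = d" using that(1) by (simp add: Compl_eq_Diff_UNIV card_Diff_subset)
    ultimately show ?thesis
      using independent_imp_int_independent unfolding is_lattice_basis_def by blast
  qed
  moreover have "x \<in> int_vectors" if T: "?P T" and x: "x \<in> L" "x \<in> coordinate_vectors I" for x T
  proof -
    have "x \<in> int_span (?E \<union> T)" using T x(1) by (simp add: is_lattice_basis_def)
    then obtain s t where st: "x = s + t" "s \<in> int_span ?E" "t \<in> int_span T"
      unfolding int_module.span_Un by blast
    have "of_int (int q) *\<^sub>R x \<in> int_vectors \<inter> coordinate_vectors I"
      using q(2)[OF x(1)] int_module.subspace_scale[OF subspace_coordinate_vectors x(2), of "int q"]
      by simp
    then have "of_int (int q) *\<^sub>R x \<in> int_span ?E" by (simp only: int_vectors_coordinate)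
    then have "of_int (int q) *\<^sub>R x - of_int (int q) *\<^sub>R s \<in> int_span ?E"
      by (rule int_module.span_diff[OF _ int_module.span_scale[OF st(2)]])
    then have "of_int (int q) *\<^sub>R t \<in> int_span ?E \<inter> int_span T"
      using int_module.span_scale[OF st(3), of "int q"] by (simp add: st(1) algebra_simps)
    then have "of_int (int q) *\<^sub>R t = 0"
      using int_independent_Un_span_Int[of ?E T] T unfolding is_lattice_basis_def by blast
    then have "t = 0" using q(1) by simp
    with st(1) have "x = s" by simp
    with st(2) have "x \<in> int_span ?E" by simp
    then show ?thesis unfolding int_vectors_coordinate[symmetric] by simp
  qed
  ultimately show ?thesis unfolding card by blast
qed

text \<open>In this form the defect depends on \<open>L\<close> only through the index sets that are
  primitive in it, which is what makes two lattices comparable.\<close>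

lemma defect_eq_Least_primitive:
  fixes L :: "(real ^ 'n) set"
  assumes L: "int_module.subspace L" "int_vectors \<subseteq> L"
    and q: "q > 0" "\<And>x. x \<in> L \<Longrightarrow> of_nat q *\<^sub>R x \<in> int_vectors"
  shows "defect L =
    (LEAST d. \<exists>I::'n set. card I + d = CARD('n) \<and> L \<inter> coordinate_vectors I \<subseteq> int_vectors)"
proof -
  \<comment> \<open>Quantification over subsets of the standard basis is replaced by quantification
    over index sets.\<close>
  have range_ex: "(\<exists>S T. S \<subseteq> range f \<and> Q S T) \<longleftrightarrow> (\<exists>I T. Q (f ` I) T)"
    for f :: "'n \<Rightarrow> real ^ 'n" and Q :: "(real ^ 'n) set \<Rightarrow> (real ^ 'n) set \<Rightarrow> bool"
    unfolding subset_image_iff by blast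
  have "(\<exists>S T. S \<subseteq> std_basis \<and> card S + d = CARD('n) \<and> T \<subseteq> L \<and> finite T \<and> card T = d \<and>
        S \<inter> T = {} \<and> is_lattice_basis (S \<union> T) L) \<longleftrightarrow>
      (\<exists>I::'n set. card I + d = CARD('n) \<and> L \<inter> coordinate_vectors I \<subseteq> int_vectors)" for d
    unfolding std_basis_def
    by (rule trans[OF range_ex]) (rule iff_exI[OF extends_to_basis_iff_primitive[OF L q]])
  then show ?thesis unfolding defect_def by simp
qed

section \<open>Denominators and multiples of prime order\<close>

lemma rat_vector_denominator:
  fixes x :: "real ^ 'n"
  assumes "x \<in> rat_vectors"
  shows "\<exists>N::nat. N > 0 \<and> of_nat N *\<^sub>R x \<in> int_vectors"
proof -
  have "\<exists>N::nat. N > 0 \<and> of_nat N * x $ i \<in> \<int>" for i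
  proof -
    have "x $ i \<in> \<rat>" using assms by (simp add: rat_vectors_def)
    then obtain k l :: int where kl: "l > 0" "x $ i = of_int k / of_int l"
      by (auto elim: Rats_cases')
    then have "of_nat (nat l) * x $ i = of_int k" by simp
    with kl(1) show ?thesis by (intro exI[of _ "nat l"]) auto
  qed
  then obtain N where N: "\<And>i. N i > (0::nat)" "\<And>i. of_nat (N i) * x $ i \<in> \<int>" by metis
  have "of_nat (\<Prod>i\<in>UNIV. N i) * x $ i \<in> \<int>" for i
  proof -
    have "of_nat (\<Prod>i\<in>UNIV. N i) * x $ i = of_nat (\<Prod>j\<in>UNIV - {i}. N j) * (of_nat (N i) * x $ i)"
      by (subst prod.remove[of UNIV i]) auto
    also have "\<dots> \<in> \<int>" by (rule Ints_mult[OF Ints_of_nat N(2)])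
    finally show ?thesis .
  qed
  then show ?thesis
    using N(1) by (intro exI[of _ "\<Prod>i\<in>UNIV. N i"]) (auto simp: int_vectors_def)
qed

lemma subspace_scaled_int_vectors:
  "int_module.subspace {x. of_nat N *\<^sub>R x \<in> int_vectors}"
  by (auto simp: int_module.subspace_def int_vectors_def distrib_left mult.left_commute)

lemma rat_vectors_common_denominator:
  fixes a :: "nat \<Rightarrow> real ^ 'n"
  assumes "\<forall>i\<in>{1..m}. a i \<in> rat_vectors"
  obtains N :: nat where "N > 0"
    "\<And>x. x \<in> int_span (int_vectors \<union> a ` {1..m}) \<Longrightarrow> of_nat N *\<^sub>R x \<in> int_vectors"
proof -
  obtain D where D: "\<And>i. i \<in> {1..m} \<Longrightarrow> D i > (0::nat)"
    "\<And>i. i \<in> {1..m} \<Longrightarrow> of_nat (D i) *\<^sub>R a i \<in> int_vectors"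
    using bchoice[of "{1..m}" "\<lambda>i N. N > 0 \<and> of_nat N *\<^sub>R a i \<in> int_vectors"]
      assms rat_vector_denominator by blast
  define N where "N = (\<Prod>i\<in>{1..m}. D i)"
  have "of_nat N *\<^sub>R a i \<in> int_vectors" if "i \<in> {1..m}" for i
  proof -
    have "D i dvd N" unfolding N_def using that by (intro dvd_prodI) auto
    then obtain c where "N = D i * c" by (rule dvdE)
    then show ?thesis
      using int_module.subspace_scale[OF subspace_int_vectors D(2)[OF that], of "int c"]
      by (simp add: mult.commute)
  qed
  then have "int_span (int_vectors \<union> a ` {1..m}) \<subseteq> {x. of_nat N *\<^sub>R x \<in> int_vectors}"
    by (intro int_module.span_minimal subspace_scaled_int_vectors) (auto simp: int_vectors_def)
  moreover have "N > 0" unfolding N_def using D(1) by (auto intro!: prod_pos)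
  ultimately show ?thesis using that by blast
qed

text \<open>Prime factors are stripped from \<open>N\<close>: with \<open>N = p * k\<close>, either
  \<open>k\<close> times \<open>x\<close> is not integral and has order \<open>p\<close> modulo the
  integral vectors, or \<open>k\<close> replaces \<open>N\<close>.\<close>

lemma prime_order_multiple:
  fixes x :: "real ^ 'n"
  assumes "N > 0" "of_nat N *\<^sub>R x \<in> int_vectors" "x \<notin> int_vectors"
  shows "\<exists>p k :: nat. prime p \<and> p dvd N \<and> of_nat k *\<^sub>R x \<notin> int_vectors \<and>
    of_nat p *\<^sub>R (of_nat k *\<^sub>R x) \<in> int_vectors"
  using assms(1,2)
proof (induction N rule: less_induct)
  case (less N)
  have "N \<noteq> 1" using less.prems assms(3) by auto
  then obtain p where p: "prime p" "p dvd N" using prime_factor_nat by blast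
  then obtain k where k: "N = p * k" by (auto elim: dvdE)
  show ?case
  proof (cases "of_nat k *\<^sub>R x \<in> int_vectors")
    case True
    have "k < N" "k > 0" using k less.prems(1) prime_gt_1_nat[OF p(1)] by auto
    from less.IH[OF this True] show ?thesis using k by (metis dvd_mult)
  next
    case False
    then show ?thesis using p k less.prems(2) by (intro exI[of _ p] exI[of _ k]) auto
  qed
qed

lemma squarefree_radical_nat:
  fixes N :: nat
  shows "squarefree (\<Prod>(prime_factors N))"
  by (rule squarefree_prod_coprime)
    (auto intro: primes_coprime squarefree_prime simp: in_prime_factors_iff)

section \<open>Passing to the sublattice with square-free denominator\<close>

lemma squarefree_lattice_same_defect:
  fixes L :: "(real ^ 'n) set"
  assumes "L \<in> lattices_gen m" "octahedron_admissible L"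
  obtains L' :: "(real ^ 'n) set" where "L' \<in> lattices_gen_squarefree m" "octahedron_admissible L'" "defect L' = defect L"
proof -
  from assms(1) obtain a where a: "L = int_span (int_vectors \<union> a ` {1..m})"
    "\<forall>i\<in>{1..m}. a i \<in> rat_vectors" by (auto simp: lattices_gen_def)
  from rat_vectors_common_denominator[OF a(2)] obtain N :: nat where N: "N > 0"
    "\<And>x. x \<in> L \<Longrightarrow> of_nat N *\<^sub>R x \<in> int_vectors" unfolding a(1) by blast
  have L: "int_module.subspace L" "int_vectors \<subseteq> L"
    unfolding a(1) using int_module.span_superset[of "int_vectors \<union> a ` {1..m}"]
    by (simp_all add: int_module.subspace_span)
  have Lrat: "L \<subseteq> rat_vectors"
    unfolding a(1) by (intro int_module.span_minimal subspace_rat_vectors)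
      (use a(2) int_vectors_subset_rat_vectors in auto)
  \<comment> \<open>Any common denominator \<open>N\<close> serves in place of the exponent: all
    that matters is that \<open>q\<close> is square-free and divisible by every prime that can be
    the order of a class.\<close>
  define q where "q = \<Prod>(prime_factors N)"
  have q: "q > 0" "squarefree q"
    unfolding q_def by (auto intro!: prod_pos squarefree_radical_nat simp: in_prime_factors_iff prime_gt_0_nat)
  define L' where "L' = L \<inter> {x. of_nat q *\<^sub>R x \<in> int_vectors}"
  have L': "int_module.subspace L'" "int_vectors \<subseteq> L'"
    unfolding L'_def using L subspace_scaled_int_vectors
    by (auto intro!: int_module.subspace_inter simp: int_vectors_def)
  have L'q: "of_nat q *\<^sub>R x \<in> int_vectors" if "x \<in> L'" for x using that by (simp add: L'_def)
  obtain b where b: "\<forall>i\<in>{1..m}. b i \<in> L'" "L' = int_span (int_vectors \<union> b ` {1..m})"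
    using subgroup_generated_by_same_number[OF subspace_int_vectors L', of a m]
    unfolding L'_def a(1) by blast
  have mem: "L' \<in> lattices_gen_squarefree m"
    unfolding lattices_gen_squarefree_def mem_Collect_eq
  proof (intro exI conjI)
    show "\<forall>i\<in>{1..m}. b i \<in> rat_vectors" using b(1) Lrat L'_def by blast
    show "\<forall>i\<in>{1..m}. of_nat q *\<^sub>R b i \<in> int_vectors" using b(1) L'q by blast
  qed (use b(2) q in auto)
  have std: "{0} \<union> std_basis \<union> uminus ` std_basis \<subseteq> (int_vectors :: (real ^ 'n) set)"
    by (auto simp: std_basis_def int_vectors_def axis_def)
  \<comment> \<open>No new points enter because \<open>L'\<close> is contained in \<open>L\<close>,
    and the required ones remain because they are integral.\<close>
  have adm: "octahedron_admissible L'"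
    using assms(2) std L'(2) unfolding octahedron_admissible_def by (auto simp: L'_def)
  \<comment> \<open>A non-integral vector of \<open>L\<close> supported on \<open>I\<close> would
    have a multiple of prime order dividing \<open>q\<close>. This multiple is still supported on
    \<open>I\<close>, lies in \<open>L'\<close> and is not integral.\<close>
  have prim: "L \<inter> coordinate_vectors I \<subseteq> int_vectors"
    if I: "L' \<inter> coordinate_vectors I \<subseteq> int_vectors" for I
  proof (rule ccontr)
    assume "\<not> ?thesis"
    then obtain x where x: "x \<in> L" "x \<in> coordinate_vectors I" "x \<notin> int_vectors" by auto
    from prime_order_multiple[OF N(1) N(2)[OF x(1)] x(3)] obtain p k :: nat where
      p: "prime p" "p dvd N" and k: "of_nat k *\<^sub>R x \<notin> int_vectors"
      "of_nat p *\<^sub>R (of_nat k *\<^sub>R x) \<in> int_vectors" by blast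
    have "p dvd q" unfolding q_def using p N(1) by (intro dvd_prod_eqI) (auto simp: in_prime_factors_iff)
    then obtain c where c: "q = p * c" by (rule dvdE)
    have "of_nat q *\<^sub>R (of_nat k *\<^sub>R x) \<in> int_vectors"
      using int_module.subspace_scale[OF subspace_int_vectors k(2), of "int c"]
      by (simp add: c ac_simps)
    moreover have "of_nat k *\<^sub>R x \<in> L \<inter> coordinate_vectors I"
      using int_module.subspace_scale[OF int_module.subspace_inter[OF L(1) subspace_coordinate_vectors], of x I "int k"]
        x by simp
    ultimately show False using I k(1) by (auto simp: L'_def)
  qed
  have prim_iff: "L' \<inter> coordinate_vectors I \<subseteq> int_vectors \<longleftrightarrow> L \<inter> coordinate_vectors I \<subseteq> int_vectors" for I
    using prim[of I] by (auto simp: L'_def)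
  have "defect L' =
      (LEAST d. \<exists>I::'n set. card I + d = CARD('n) \<and> L' \<inter> coordinate_vectors I \<subseteq> int_vectors)"
    using L' q(1) L'q by (rule defect_eq_Least_primitive)
  also have "\<dots> = defect L"
    unfolding prim_iff using L N by (rule defect_eq_Least_primitive[symmetric])
  finally have "defect L' = defect L" .
  with mem adm show ?thesis by (rule that)
qed

theorem theorem3:
  fixes m :: nat
  assumes "m \<ge> 1"
  shows "max_defect_squarefree TYPE('n::finite) m = max_defect TYPE('n) m"
proof -
  \<comment> \<open>The two sets of attained defects coincide, so their maxima agree without being
    computed.\<close>
  have "lattices_gen_squarefree m \<subseteq> (lattices_gen m :: (real ^ 'n) set set)"
    unfolding lattices_gen_squarefree_def lattices_gen_def by blast
  moreover have "\<exists>L' :: (real ^ 'n) set. defect L = defect L' \<and>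
      L' \<in> lattices_gen_squarefree m \<and> octahedron_admissible L'"
    if "L \<in> lattices_gen m" "octahedron_admissible L" for L :: "(real ^ 'n) set"
    by (rule squarefree_lattice_same_defect[OF that]) (intro exI conjI; simp)
  ultimately have "{defect L | L :: (real ^ 'n) set. L \<in> lattices_gen_squarefree m \<and> octahedron_admissible L} =
    {defect L | L :: (real ^ 'n) set. L \<in> lattices_gen m \<and> octahedron_admissible L}"
    by blast
  then show ?thesis by (simp add: max_defect_squarefree_def max_defect_def)
qed

end
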